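(* Let $\mathcal{A}\in T_{m,n}$ be a $Z$-tensor, $q\in\mathbb{R}^n$ and $p\in(0,1)$. Let $\{t_k\}$ be any sequence of positive real numbers converging to $0$ and, for each $k$, let $u_{t_k}$ be a solution (global minimizer) of $$\min_{u\in\mathbb{R}^n}\ \tfrac12\|\Phi_{FB}(u)\|^2+t\|u\|_p^p$$ with $t=t_k$. Suppose $\mathrm{SOL}(q,\mathcal{A})$ is nonempty. Then any accumulation point $u^*$ of $\{u_{t_k}\}$ is a sparse solution of $\mathrm{TCP}(q,\mathcal{A})$.
   Context: $T_{m,n}$ is the set of real tensors $\mathcal{A}=(a_{i_1\ldots i_m})$ of order $m\ge 2$ and dimension $n$. For $u\in\mathbb{R}^n$, $\mathcal{A}u^{m-1}\in\mathbb{R}^n$ is the vector with $(\mathcal{A}u^{m-1})_i=\sum_{i_2,\ldots,i_m=1}^n a_{i i_2\ldots i_m}u_{i_2}\cdots u_{i_m}$. $\mathcal{A}$ is a $Z$-tensor if all its off-diagonal entries (those $a_{i_1\ldots i_m}$ for which $i_1,\ldots,i_m$ are not all equal) are nonpositive. $\mathrm{SOL}(q,\mathcal{A})=\{u\in\mathbb{R}^n: u\ge 0,\ \mathcal{A}u^{m-1}+q\ge 0,\ u^T(\mathcal{A}u^{m-1}+q)=0\}$ (componentwise inequalities) is the solution set of the tensor complementarity problem $\mathrm{TCP}(q,\mathcal{A})$. $\|u\|_0$ denotes the number of nonzero components of $u$. A sparse solution of $\mathrm{TCP}(q,\mathcal{A})$ is an element $u^*\in\mathrm{SOL}(q,\mathcal{A})$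 with $\|u^*\|_0\le\|u\|_0$ for all $u\in\mathrm{SOL}(q,\mathcal{A})$. The Fischer-Burmeister function is $\phi_{FB}(a,b)=\sqrt{a^2+b^2}-(a+b)$ for $a,b\in\mathbb{R}$, and $\Phi_{FB}:\mathbb{R}^n\to\mathbb{R}^n$ is defined by $\Phi_{FB}(u)_i=\phi_{FB}(u_i,(q+\mathcal{A}u^{m-1})_i)$, $i=1,\ldots,n$. $\|\cdot\|$ is the Euclidean norm and $\|u\|_p^p=\sum_{i=1}^n|u_i|^p$. *)

theory Defs
  imports "HOL-Analysis.Analysis"
begin

text \<open>
  A real tensor of order \<open>m\<close> and dimension \<open>CARD('n)\<close> is a function on multi-indices,
  the multi-index \<open>(i\<^sub>1, \<dots>, i\<^sub>m)\<close> being the list \<open>[i\<^sub>1, \<dots>, i\<^sub>m]\<close>. Only the values on lists of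
  length \<open>m\<close> are entries of the tensor; the order is therefore passed explicitly to every
  notion below, and the values on lists of other lengths are never used.
\<close>

type_synonym 'n tensor = "'n list \<Rightarrow> real"

definition tensor_app :: "nat \<Rightarrow> 'n::finite tensor \<Rightarrow> real ^ 'n \<Rightarrow> real ^ 'n" where
  "tensor_app m A u =
     (\<chi> i. \<Sum>js | length js = m - 1. A (i # js) * (\<Prod>j\<leftarrow>js. u $ j))"

definition Z_tensor :: "nat \<Rightarrow> 'n::finite tensor \<Rightarrow> bool" where
  "Z_tensor m A \<longleftrightarrow>
     (\<forall>is. length is = m \<and> \<not> (\<exists>i. is = replicate m i) \<longrightarrow> A is \<le> 0)"

text \<open>The order on \<open>real ^ 'n\<close> is the componentwise one.\<close>

definition SOL :: "nat \<Rightarrow> real ^ 'n \<Rightarrow> 'n::finite tensor \<Rightarrow> (real ^ 'n) set" where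
  "SOL m q A = {u. 0 \<le> u \<and> 0 \<le> tensor_app m A u + q \<and> u \<bullet> (tensor_app m A u + q) = 0}"

definition l0norm :: "real ^ 'n::finite \<Rightarrow> nat" where
  "l0norm u = card {i. u $ i \<noteq> 0}"

definition sparse_solution ::
  "nat \<Rightarrow> real ^ 'n \<Rightarrow> 'n::finite tensor \<Rightarrow> real ^ 'n \<Rightarrow> bool" where
  "sparse_solution m q A u \<longleftrightarrow> u \<in> SOL m q A \<and> (\<forall>v \<in> SOL m q A. l0norm u \<le> l0norm v)"

definition phi_FB :: "real \<Rightarrow> real \<Rightarrow> real" where
  "phi_FB a b = sqrt (a\<^sup>2 + b\<^sup>2) - (a + b)"

definition Phi_FB ::
  "nat \<Rightarrow> real ^ 'n \<Rightarrow> 'n::finite tensor \<Rightarrow> real ^ 'n \<Rightarrow> real ^ 'n" where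
  "Phi_FB m q A u = (\<chi> i. phi_FB (u $ i) ((q + tensor_app m A u) $ i))"

text \<open>\<open>lp_pow p u\<close> is \<open>\<parallel>u\<parallel>\<^sub>p\<^sup>p\<close>; note that \<open>0 powr p = 0\<close>.\<close>

definition lp_pow :: "real \<Rightarrow> real ^ 'n::finite \<Rightarrow> real" where
  "lp_pow p u = (\<Sum>i\<in>UNIV. \<bar>u $ i\<bar> powr p)"

definition FB_objective ::
  "nat \<Rightarrow> real ^ 'n \<Rightarrow> 'n::finite tensor \<Rightarrow> real \<Rightarrow> real \<Rightarrow> real ^ 'n \<Rightarrow> real" where
  "FB_objective m q A p t u = 1 / 2 * (norm (Phi_FB m q A u))\<^sup>2 + t * lp_pow p u"

definition accumulation_point :: "(nat \<Rightarrow> 'a::topological_space) \<Rightarrow> 'a \<Rightarrow> bool" where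
  "accumulation_point x l \<longleftrightarrow> (\<exists>r::nat \<Rightarrow> nat. strict_mono r \<and> (x \<circ> r) \<longlonglongrightarrow> l)"

end

theory Submission
  imports Defs
begin

text \<open>
  Comparing a minimizer for \<open>t\<^sub>k\<close> with a solution \<open>v\<close> of the complementarity problem, where the
  Fischer-Burmeister term vanishes, gives \<open>\<parallel>\<Phi>(u\<^sub>k)\<parallel>\<^sup>2 / 2 + t\<^sub>k \<parallel>u\<^sub>k\<parallel>\<^sub>p\<^sup>p \<le> t\<^sub>k \<parallel>v\<parallel>\<^sub>p\<^sup>p\<close>. Along a
  convergent subsequence the first summand is squeezed to \<open>0\<close>, so the limit \<open>u\<^sup>*\<close> is itself a
  solution, and dividing by \<open>t\<^sub>k\<close> shows that \<open>u\<^sup>*\<close> minimizes \<open>\<parallel>\<sqdot>\<parallel>\<^sub>p\<^sup>p\<close> over the solution set.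

  What turns this \<open>\<ell>\<^sub>p\<close>-minimality into sparsity is the order structure that a Z-tensor imposes.
  Since the off-diagonal entries are nonpositive, lowering the other components of a nonnegative
  vector can only raise a given component of \<open>\<A> u\<^sup>m\<^sup>-\<^sup>1\<close> (\<open>tensor_app_antimono_off_diagonal\<close>).
  Hence the feasible set is closed under componentwise minima and has a least element, and that
  element satisfies complementarity, because a component with positive slack could be lowered
  further (\<open>Z_tensor_least_solution\<close>). The least element \<open>w\<close> lies below every solution, in
  particular below \<open>u\<^sup>*\<close>; as \<open>\<parallel>\<sqdot>\<parallel>\<^sub>p\<^sup>p\<close> is strictly monotone on nonnegative vectors, minimality
  forces \<open>u\<^sup>* = w\<close>. Among nonnegative vectors a smaller one has a smaller support, so \<open>u\<^sup>*\<close> is sparse.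
\<close>

section \<open>Continuity\<close>

lemma tendsto_prod_list [tendsto_intros]:
  fixes f :: "'a \<Rightarrow> 'b \<Rightarrow> real"
  assumes "\<And>j. ((\<lambda>x. f x j) \<longlongrightarrow> l j) F"
  shows "((\<lambda>x. \<Prod>j\<leftarrow>js. f x j) \<longlongrightarrow> (\<Prod>j\<leftarrow>js. l j)) F"
  by (induction js) (auto intro!: tendsto_intros assms)

lemma tendsto_tensor_app [tendsto_intros]:
  assumes "(f \<longlongrightarrow> l) F"
  shows "((\<lambda>x. tensor_app m A (f x)) \<longlongrightarrow> tensor_app m A l) F"
  unfolding tensor_app_def by (intro tendsto_intros assms)

lemma tendsto_Phi_FB [tendsto_intros]:
  assumes "(f \<longlongrightarrow> l) F"
  shows "((\<lambda>x. Phi_FB m q A (f x)) \<longlongrightarrow> Phi_FB m q A l) F"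
  unfolding Phi_FB_def phi_FB_def by (intro tendsto_intros assms)

lemma tendsto_lp_pow:
  assumes "(f \<longlongrightarrow> l) F" and "0 < p"
  shows "((\<lambda>x. lp_pow p (f x)) \<longlongrightarrow> lp_pow p l) F"
  unfolding lp_pow_def using assms by (intro tendsto_intros tendsto_powr') auto

section \<open>The Fischer-Burmeister reformulation\<close>

lemma phi_FB_eq_0_iff: "phi_FB a b = 0 \<longleftrightarrow> 0 \<le> a \<and> 0 \<le> b \<and> a * b = 0"
proof
  assume "phi_FB a b = 0"
  then have root: "sqrt (a\<^sup>2 + b\<^sup>2) = a + b"
    by (simp add: phi_FB_def)
  then have "a\<^sup>2 + b\<^sup>2 = (a + b)\<^sup>2"
    by (metis real_sqrt_pow2 sum_power2_ge_zero)
  then have "a * b = 0"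
    by (simp add: power2_sum)
  moreover have "0 \<le> a + b"
    using root by (metis real_sqrt_ge_zero sum_power2_ge_zero)
  ultimately show "0 \<le> a \<and> 0 \<le> b \<and> a * b = 0"
    by auto
qed (auto simp: phi_FB_def)

lemma mem_SOL_iff_complementary:
  "u \<in> SOL m q A \<longleftrightarrow>
     (\<forall>i. 0 \<le> u $ i \<and> 0 \<le> (tensor_app m A u + q) $ i \<and> u $ i * (tensor_app m A u + q) $ i = 0)"
proof -
  have "u \<bullet> y = 0 \<longleftrightarrow> (\<forall>i. u $ i * y $ i = 0)" if "0 \<le> u" "0 \<le> y" for y
    using that by (simp add: inner_vec_def less_eq_vec_def sum_nonneg_eq_0_iff)
  then show ?thesis
    unfolding SOL_def less_eq_vec_def by auto
qed

lemma Phi_FB_eq_0_iff: "Phi_FB m q A u = 0 \<longleftrightarrow> u \<in> SOL m q A"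
  unfolding mem_SOL_iff_complementary
  by (simp add: Phi_FB_def vec_eq_iff phi_FB_eq_0_iff add.commute)

section \<open>The least feasible vector of a Z-tensor\<close>

text \<open>
  The diagonal term of component \<open>i\<close> depends only on the \<open>i\<close>-th component, where the two vectors
  agree; every other term is a nonpositive coefficient times a monotone monomial.
\<close>

lemma tensor_app_antimono_off_diagonal:
  assumes Z: "Z_tensor m A" and m: "m \<ge> 1"
    and nonneg: "0 \<le> w" and le: "w \<le> u" and eq: "w $ i = u $ i"
  shows "tensor_app m A u $ i \<le> tensor_app m A w $ i"
proof -
  have mono: "0 \<le> (\<Prod>j\<leftarrow>js. w $ j) \<and> (\<Prod>j\<leftarrow>js. w $ j) \<le> (\<Prod>j\<leftarrow>js. u $ j)" for js
  proof (induction js)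
    case (Cons j js)
    moreover have "0 \<le> w $ j" "w $ j \<le> u $ j"
      using nonneg le by (simp_all add: less_eq_vec_def)
    ultimately show ?case
      by (auto intro!: mult_mono)
  qed simp
  have "A (i # js) * (\<Prod>j\<leftarrow>js. u $ j) \<le> A (i # js) * (\<Prod>j\<leftarrow>js. w $ j)"
    if len: "length js = m - 1" for js
  proof (cases "js = replicate (m - 1) i")
    case True
    then show ?thesis
      using eq by simp
  next
    case False
    have "i # js \<noteq> replicate m k" for k
      using False m by (cases m) auto
    moreover have "length (i # js) = m"
      using len m by simp
    ultimately have "A (i # js) \<le> 0"
      using Z unfolding Z_tensor_def by blast
    then show ?thesis
      using mono by (intro mult_left_mono_neg) auto
  qed
  then show ?thesis
    unfolding tensor_app_def by (auto intro!: sum_mono)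
qed

definition FEA :: "nat \<Rightarrow> real ^ 'n \<Rightarrow> 'n::finite tensor \<Rightarrow> (real ^ 'n) set" where
  "FEA m q A = {u. 0 \<le> u \<and> 0 \<le> tensor_app m A u + q}"

lemma SOL_subset_FEA: "SOL m q A \<subseteq> FEA m q A"
  unfolding SOL_def FEA_def by auto

lemma closed_FEA: "closed (FEA m q A)"
proof -
  have "continuous_on UNIV (tensor_app m A)"
    unfolding continuous_on_def by (intro ballI tendsto_intros)
  then have "closed {u. 0 \<le> u $ i \<and> 0 \<le> tensor_app m A u $ i + q $ i}" for i
    by (intro closed_Collect_conj closed_Collect_le continuous_intros)
  then have "closed {u. \<forall>i. 0 \<le> u $ i \<and> 0 \<le> tensor_app m A u $ i + q $ i}"
    by (rule closed_Collect_all)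
  also have "{u. \<forall>i. 0 \<le> u $ i \<and> 0 \<le> tensor_app m A u $ i + q $ i} = FEA m q A"
    by (auto simp: FEA_def less_eq_vec_def)
  finally show ?thesis .
qed

lemma FEA_inf_closed:
  assumes "Z_tensor m A" "m \<ge> 1" and u: "u \<in> FEA m q A" and v: "v \<in> FEA m q A"
  shows "inf u v \<in> FEA m q A"
proof -
  have nonneg: "0 \<le> inf u v"
    using u v by (simp add: FEA_def)
  have "0 \<le> tensor_app m A (inf u v) $ i + q $ i" for i
  proof -
    have "inf u v $ i = u $ i \<or> inf u v $ i = v $ i"
      by (auto simp: inf_vec_def inf_real_def min_def)
    then have "tensor_app m A u $ i \<le> tensor_app m A (inf u v) $ i
        \<or> tensor_app m A v $ i \<le> tensor_app m A (inf u v) $ i"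
      using tensor_app_antimono_off_diagonal[OF assms(1,2) nonneg] by (meson inf.cobounded1 inf.cobounded2)
    moreover have "0 \<le> tensor_app m A u $ i + q $ i" "0 \<le> tensor_app m A v $ i + q $ i"
      using u v by (auto simp: FEA_def less_eq_vec_def)
    ultimately show ?thesis
      by linarith
  qed
  then show ?thesis
    using nonneg by (simp add: FEA_def less_eq_vec_def)
qed

text \<open>
  A feasible vector of smallest component sum is least: its minimum with any other feasible
  vector is feasible with no larger a sum, hence equal to it.
\<close>

lemma FEA_has_least:
  assumes Z: "Z_tensor m A" "m \<ge> 1" and "FEA m q A \<noteq> {}"
  obtains w where "w \<in> FEA m q A" "\<And>v. v \<in> FEA m q A \<Longrightarrow> w \<le> v"
proof -
  obtain b where b: "b \<in> FEA m q A"
    using assms by auto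
  have "compact (FEA m q A \<inter> {0..b})"
    by (intro closed_Int_compact closed_FEA) (simp add: interval_cbox compact_cbox)
  moreover have "b \<in> FEA m q A \<inter> {0..b}"
    using b by (auto simp: FEA_def)
  moreover have "continuous_on (FEA m q A \<inter> {0..b}) (\<lambda>u. \<Sum>i\<in>UNIV. u $ i)"
    by (intro continuous_intros)
  ultimately obtain w where w: "w \<in> FEA m q A \<inter> {0..b}"
    and w_min: "\<And>v. v \<in> FEA m q A \<inter> {0..b} \<Longrightarrow> (\<Sum>i\<in>UNIV. w $ i) \<le> (\<Sum>i\<in>UNIV. v $ i)"
    using continuous_attains_inf by (metis empty_iff)
  have "w \<le> v" if v: "v \<in> FEA m q A" for v
  proof -
    have "inf w v \<in> FEA m q A"
      using FEA_inf_closed[OF Z] w v by blast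
    moreover have "inf w v \<le> b"
      using w by (auto intro: le_infI1)
    ultimately have "inf w v \<in> FEA m q A \<inter> {0..b}"
      by (simp add: FEA_def)
    then have "(\<Sum>i\<in>UNIV. w $ i - inf w v $ i) \<le> 0"
      using w_min by (simp add: sum_subtractf)
    moreover have gap: "0 \<le> w $ i - inf w v $ i" for i
      by (simp add: inf_vec_def)
    ultimately have "(\<Sum>i\<in>UNIV. w $ i - inf w v $ i) = 0"
      by (meson antisym sum_nonneg)
    then have "w = inf w v"
      using gap by (simp add: sum_nonneg_eq_0_iff vec_eq_iff)
    then show ?thesis
      by (metis inf.cobounded2)
  qed
  then show ?thesis
    using that w by blast
qed

text \<open>
  If component \<open>i\<close> of the least feasible vector and its slack were both positive, lowering
  component \<open>i\<close> slightly would keep slack \<open>i\<close> positive by continuity and could not decrease the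
  other slacks, contradicting leastness.
\<close>

theorem Z_tensor_least_solution:
  assumes Z: "Z_tensor m A" "m \<ge> 1" and "FEA m q A \<noteq> {}"
  obtains w where "w \<in> SOL m q A" "\<And>v. v \<in> SOL m q A \<Longrightarrow> w \<le> v"
proof -
  obtain w where w: "w \<in> FEA m q A" and least: "\<And>v. v \<in> FEA m q A \<Longrightarrow> w \<le> v"
    using FEA_has_least assms by blast
  have nonneg: "0 \<le> w" and slack: "0 \<le> tensor_app m A w $ i + q $ i" for i
    using w by (auto simp: FEA_def less_eq_vec_def)
  have "w $ i * (tensor_app m A w $ i + q $ i) = 0" for i
  proof (rule ccontr)
    assume "w $ i * (tensor_app m A w $ i + q $ i) \<noteq> 0"
    then have pos: "0 < w $ i" "0 < tensor_app m A w $ i + q $ i"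
      using nonneg slack[of i] by (auto simp: less_eq_vec_def order_less_le)
    define y where "y s = w - s *\<^sub>R axis i 1" for s
    have y_nth: "y s $ j = (if j = i then w $ i - s else w $ j)" for s j
      by (simp add: y_def axis_def)
    have "((\<lambda>s. tensor_app m A (y s) $ i + q $ i) \<longlongrightarrow>
        tensor_app m A (w - 0 *\<^sub>R axis i 1) $ i + q $ i) (at_right 0)"
      unfolding y_def by (intro tendsto_intros)
    then have "\<forall>\<^sub>F s in at_right 0. 0 < tensor_app m A (y s) $ i + q $ i"
      using pos by (intro order_tendstoD(1)[where y = "tensor_app m A w $ i + q $ i"]) auto
    moreover have "\<forall>\<^sub>F s in at_right 0. s \<in> {0<..<w $ i}"
      using pos by (intro eventually_at_right_real)
    ultimately have "\<forall>\<^sub>F s in at_right 0. 0 < tensor_app m A (y s) $ i + q $ i \<and> s \<in> {0<..<w $ i}"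
      by (rule eventually_conj)
    then obtain s where s: "0 < tensor_app m A (y s) $ i + q $ i" "0 < s" "s < w $ i"
      using eventually_happens'[OF trivial_limit_at_right_real] by fastforce
    have y_nonneg: "0 \<le> y s" and y_le: "y s \<le> w"
      using nonneg s by (auto simp: less_eq_vec_def y_nth)
    have "0 \<le> tensor_app m A (y s) $ j + q $ j" for j
    proof (cases "j = i")
      case False
      then have "tensor_app m A w $ j \<le> tensor_app m A (y s) $ j"
        using tensor_app_antimono_off_diagonal[OF Z y_nonneg y_le] by (simp add: y_nth)
      then show ?thesis
        using slack[of j] by linarith
    qed (use s in simp)
    then have "w \<le> y s"
      using y_nonneg by (intro least) (simp add: FEA_def less_eq_vec_def)
    then have "w $ i \<le> y s $ i"
      by (simp add: less_eq_vec_def)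
    then show False
      using s by (simp add: y_nth)
  qed
  then have "w \<in> SOL m q A"
    using nonneg slack by (simp add: mem_SOL_iff_complementary less_eq_vec_def)
  then show ?thesis
    using that least SOL_subset_FEA by blast
qed

section \<open>Comparing nonnegative vectors\<close>

lemma eq_if_le_and_lp_pow_le:
  assumes "0 < p" "0 \<le> w" "w \<le> v" "lp_pow p v \<le> lp_pow p w"
  shows "v = w"
proof -
  have nn: "0 \<le> w $ i" "w $ i \<le> v $ i" for i
    using assms by (auto simp: less_eq_vec_def)
  have gap: "0 \<le> \<bar>v $ i\<bar> powr p - \<bar>w $ i\<bar> powr p" for i
    using nn[of i] assms by (simp add: powr_mono2)
  have "(\<Sum>i\<in>UNIV. \<bar>v $ i\<bar> powr p - \<bar>w $ i\<bar> powr p) \<le> 0"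
    using assms(4) by (simp add: lp_pow_def sum_subtractf)
  then have "(\<Sum>i\<in>UNIV. \<bar>v $ i\<bar> powr p - \<bar>w $ i\<bar> powr p) = 0"
    using gap by (meson antisym sum_nonneg)
  then have eq: "\<bar>v $ i\<bar> powr p = \<bar>w $ i\<bar> powr p" for i
    using gap by (simp add: sum_nonneg_eq_0_iff)
  have "v $ i = w $ i" for i
    using nn[of i] eq[of i] powr_less_mono2[OF assms(1), of "w $ i" "v $ i"] by force
  then show ?thesis
    by (simp add: vec_eq_iff)
qed

lemma l0norm_mono:
  assumes "0 \<le> w" "w \<le> v"
  shows "l0norm w \<le> l0norm v"
proof -
  have "{i. w $ i \<noteq> 0} \<subseteq> {i. v $ i \<noteq> 0}"
    using assms unfolding less_eq_vec_def by (auto intro: antisym) (metis order_antisym)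
  then show ?thesis
    unfolding l0norm_def by (simp add: card_mono)
qed

section \<open>Limits of the regularized minimizers\<close>

text \<open>
  This part holds for an arbitrary tensor: in the limit the penalty enforces membership in the
  solution set and, among solutions, selects those of least \<open>\<ell>\<^sub>p\<close> value.
\<close>

lemma limit_of_minimizers:
  assumes p: "0 < p" and t_pos: "\<And>k. t k > 0" and t_lim: "t \<longlonglongrightarrow> 0"
    and min: "\<And>k. is_arg_min (FB_objective m q A p (t k)) (\<lambda>_. True) (x k)"
    and lim: "x \<longlonglongrightarrow> l" and v: "v \<in> SOL m q A"
  shows "l \<in> SOL m q A" and "lp_pow p l \<le> lp_pow p v"
proof -
  have bound: "1 / 2 * (norm (Phi_FB m q A (x k)))\<^sup>2 + t k * lp_pow p (x k) \<le> t k * lp_pow p v" for k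
  proof -
    have "FB_objective m q A p (t k) (x k) \<le> FB_objective m q A p (t k) v"
      using min[of k] by (simp add: is_arg_min_linorder)
    then show ?thesis
      using v by (simp add: FB_objective_def flip: Phi_FB_eq_0_iff)
  qed
  have lp_nonneg: "0 \<le> lp_pow p y" for y :: "real ^ 'a"
    unfolding lp_pow_def by (simp add: sum_nonneg)
  have "lp_pow p (x k) \<le> lp_pow p v" for k
  proof -
    have "t k * lp_pow p (x k) \<le> t k * lp_pow p v"
      using bound[of k] zero_le_power2[of "norm (Phi_FB m q A (x k))"] by linarith
    then show ?thesis
      using t_pos[of k] by simp
  qed
  then show "lp_pow p l \<le> lp_pow p v"
    using tendsto_lp_pow[OF lim p] by (intro LIMSEQ_le_const2) auto
  have "1 / 2 * (norm (Phi_FB m q A (x k)))\<^sup>2 \<le> t k * lp_pow p v" for k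
  proof -
    have "0 \<le> t k * lp_pow p (x k)"
      using t_pos[of k] lp_nonneg[of "x k"] by simp
    then show ?thesis
      using bound[of k] by linarith
  qed
  moreover have "(\<lambda>k. 1 / 2 * (norm (Phi_FB m q A (x k)))\<^sup>2)
      \<longlonglongrightarrow> 1 / 2 * (norm (Phi_FB m q A l))\<^sup>2"
    by (intro tendsto_intros lim)
  moreover have "(\<lambda>k. t k * lp_pow p v) \<longlonglongrightarrow> 0 * lp_pow p v"
    by (intro tendsto_intros t_lim)
  ultimately have "1 / 2 * (norm (Phi_FB m q A l))\<^sup>2 \<le> 0 * lp_pow p v"
    by (intro LIMSEQ_le[where X = "\<lambda>k. 1 / 2 * (norm (Phi_FB m q A (x k)))\<^sup>2"]) auto
  then have "Phi_FB m q A l = 0"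
    by simp
  then show "l \<in> SOL m q A"
    by (simp add: Phi_FB_eq_0_iff)
qed

theorem corollary1:
  fixes m :: nat
    and A :: "'n::finite tensor"
    and q :: "real ^ 'n"
    and p :: real
    and t :: "nat \<Rightarrow> real"
    and u :: "nat \<Rightarrow> real ^ 'n"
    and u_star :: "real ^ 'n"
  assumes "m \<ge> 2"
    and "Z_tensor m A"
    and "0 < p" and "p < 1"
    and "\<And>k. t k > 0"
    and "t \<longlonglongrightarrow> 0"
    and "\<And>k. is_arg_min (FB_objective m q A p (t k)) (\<lambda>_. True) (u k)"
    and "SOL m q A \<noteq> {}"
    and "accumulation_point u u_star"
  shows "sparse_solution m q A u_star"
proof -
  have "FEA m q A \<noteq> {}"
    using assms(8) SOL_subset_FEA by blast
  moreover have "m \<ge> 1"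
    using assms(1) by simp
  ultimately obtain w where w: "w \<in> SOL m q A" and least: "\<And>v. v \<in> SOL m q A \<Longrightarrow> w \<le> v"
    using Z_tensor_least_solution[OF assms(2)] by blast
  obtain r where r: "strict_mono r" and lim: "(u \<circ> r) \<longlonglongrightarrow> u_star"
    using assms(9) unfolding accumulation_point_def by blast
  have t_lim: "(t \<circ> r) \<longlonglongrightarrow> 0"
    using LIMSEQ_subseq_LIMSEQ[OF assms(6) r] .
  have sol: "u_star \<in> SOL m q A" and "lp_pow p u_star \<le> lp_pow p w"
    using limit_of_minimizers[OF assms(3) _ t_lim _ lim w] assms(5,7) by simp_all
  moreover have nonneg: "0 \<le> w"
    using w by (simp add: SOL_def)
  ultimately have "u_star = w"
    using eq_if_le_and_lp_pow_le[OF assms(3)] least by blast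
  then show ?thesis
    unfolding sparse_solution_def using sol least nonneg l0norm_mono by blast
qed

end
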